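(* Let $\mathcal Y,\mathcal X,\mathcal U$ be measurable spaces, $\mathcal W=\mathcal X\times\mathcal U$, and suppose $\mathcal Z=\mathcal Y\times\mathcal X$ is finite with every subset measurable. Let $\theta\in\Theta$ be fixed, let $\Gamma_\theta$ and $L_\theta$ be as in the context, and let $\mu^*\in\mathcal P(\mathcal Z)$. Let $\mathcal W'\subseteq\mathcal W$ be nonempty and finite, and let $\mathcal J'\subseteq\mathcal J$ and $\mathcal K'\subseteq\mathcal K$ be finite. If $(\mathcal J',\mathcal K')$ is column-certified for $\mathcal W'$ and $\mathcal W'$ is row-certified for $(\mathcal J',\mathcal K')$, then $$T_{\mathrm{LP}}(\theta)=T(\theta).$$
   Context: $\mathcal P(\mathcal S)$ is the set of probability measures on $\mathcal S$; products carry product $\sigma$-algebras; $\delta_w$ is the Dirac measure at $w$. Admissible input measures: $\Gamma_\theta=\{\gamma\in\mathcal P(\mathcal W):\mathbb E_\gamma[g_{1,j}(W;\theta)]=0\ \forall j\in\mathcal J,\ \mathbb E_\gamma[g_{2,k}(W;\theta)]\le0\ \forall k\in\mathcal K\}$, where $\mathcal J,\mathcal K$ are arbitrary index sets and the $g$'s are real-valued measurable functions on $\mathcal W$ (membership in $\Gamma_\theta$ requires their $\gamma$-integrability). Output operator: $K_\theta$ is a probability kernel from $\mathcal W$ to $\mathcal Z$, not depending on $\gamma$, whose $\mathcal X$-marginal at $(x,u)$ is $\delta_x$; $(L_\theta\gamma)(B)=\int K_\theta(B\mid w)\,d\gamma(w)$. Target: $T(\theta)=\sup_{\phi\in[0,1]^{\mathcal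 Z}}\inf_{\gamma\in\Gamma_\theta}(\mathbb E_{\mu^*}[\phi]-\mathbb E_{L_\theta\gamma}[\phi])$, with $\inf\varnothing=+\infty$. Restricted discrepancy: for $\mathcal J''\subseteq\mathcal J$, $\mathcal K''\subseteq\mathcal K$ (finite, or the full index sets), let $\Gamma_\theta(\mathcal W',\mathcal J'',\mathcal K'')$ be the set of measures $\gamma_p=\sum_{w\in\mathcal W'}p_w\delta_w$ with $p_w\ge0$, $\sum_{w\in\mathcal W'} p_w=1$, $\mathbb E_{\gamma_p}[g_{1,j}(W;\theta)]=0$ for all $j\in\mathcal J''$ and $\mathbb E_{\gamma_p}[g_{2,k}(W;\theta)]\le0$ for all $k\in\mathcal K''$, and $$T(\theta;\mathcal W',\mathcal J'',\mathcal K'')=\sup_{\phi\in[0,1]^{\mathcal Z}}\inf_{\gamma_p\in\Gamma_\theta(\mathcal W',\mathcal J'',\mathcal K'')}(\mathbb E_{\mu^*}[\phi]-\mathbb E_{L_\theta\gamma_p}[\phi]).$$ Put $T_{\mathrm{LP}}(\theta)=T(\theta;\mathcal W',\mathcal J',\mathcal K')$. By linear programming duality $T_{\mathrm{LP}}(\theta)$ is the value of the auxiliary finite linear program: maximize $\mathbb E_{\mu^*}[\phi]-\zeta$ over $\phi\in[0,1]^{\mathcal Z}$, $\zeta\in\mathbb R$, $u\in\mathbb R^{\mathcal J'}$, $v\in\mathbb R_+^{\mathcal K'}$ subject to $s(w;\phi,\zeta,u,v)\ge0$ for all $w\in\mathcal W'$, where for every $w\in\mathcal W$ $$s(w;\phi,\zeta,u,v)=\zeta+\sum_{j\in\mathcal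 J'}u_jg_{1,j}(w;\theta)+\sum_{k\in\mathcal K'}v_kg_{2,k}(w;\theta)-q_{\phi,\theta}(w),\qquad q_{\phi,\theta}(w)=\sum_{z\in\mathcal Z}\phi(z)K_\theta(\{z\}\mid w).$$ Column certification: $(\mathcal J',\mathcal K')$ is column-certified for $\mathcal W'$ if $\Gamma_\theta(\mathcal W',\mathcal J,\mathcal K)\neq\varnothing$ and $T(\theta;\mathcal W',\mathcal J',\mathcal K')=T(\theta;\mathcal W',\mathcal J,\mathcal K)$. Row certification: for an optimizer $(\phi^*,\zeta^*,u^*,v^* )$ of the auxiliary linear program, its row residual is $r^*=\inf_{w\in\mathcal W}s(w;\phi^*,\zeta^*,u^*,v^* )$. The support $\mathcal W'$ is row-certified for $(\mathcal J',\mathcal K')$ if $r^*=0$ at some optimizer of the auxiliary linear program. *)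

theory Defs
  imports "HOL-Probability.Probability"
begin

(* Measurable spaces are represented by "measure" objects of which only
   the carrier and the sigma-algebra matter.
   W is the input space, Z the output space. *)

definition admissible ::
  "'w measure \<Rightarrow> ('j \<Rightarrow> 'w \<Rightarrow> real) \<Rightarrow> ('k \<Rightarrow> 'w \<Rightarrow> real) \<Rightarrow> 'j set \<Rightarrow> 'k set \<Rightarrow> 'w measure set"
  where
  "admissible W g1 g2 J K =
    {\<gamma> \<in> space (prob_algebra W).
       (\<forall>j\<in>J. integrable \<gamma> (g1 j) \<and> (\<integral>w. g1 j w \<partial>\<gamma>) = 0) \<and>
       (\<forall>k\<in>K. integrable \<gamma> (g2 k) \<and> (\<integral>w. g2 k w \<partial>\<gamma>) \<le> 0)}"

definition output_kernel ::
  "'y measure \<Rightarrow> 'x measure \<Rightarrow> 'u measure \<Rightarrow> ('x \<times> 'u \<Rightarrow> ('y \<times> 'x) measure) \<Rightarrow> bool"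
  where
  "output_kernel Y X U \<kappa> \<longleftrightarrow>
    \<kappa> \<in> (X \<Otimes>\<^sub>M U) \<rightarrow>\<^sub>M prob_algebra (Y \<Otimes>\<^sub>M X) \<and>
    (\<forall>x\<in>space X. \<forall>u\<in>space U. distr (\<kappa> (x, u)) X snd = return X x)"

definition output_law :: "('w \<Rightarrow> 'z measure) \<Rightarrow> 'w measure \<Rightarrow> 'z measure" where
  "output_law \<kappa> \<gamma> = \<gamma> \<bind> \<kappa>"

(* The value lies in ereal, so that the infimum over an empty set of input measures is \<infinity>.
   Test functions may be arbitrary outside the carrier of Z, which no integral sees. *)
definition discrepancy ::
  "'z measure \<Rightarrow> 'z measure \<Rightarrow> ('w \<Rightarrow> 'z measure) \<Rightarrow> 'w measure set \<Rightarrow> ereal"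
  where
  "discrepancy Z \<mu> \<kappa> G =
    (SUP \<phi> \<in> space Z \<rightarrow> {0..1::real}.
      INF \<gamma> \<in> G. ereal ((\<integral>z. \<phi> z \<partial>\<mu>) - (\<integral>z. \<phi> z \<partial>output_law \<kappa> \<gamma>)))"

definition target_T ::
  "'w measure \<Rightarrow> 'z measure \<Rightarrow> 'z measure \<Rightarrow> ('w \<Rightarrow> 'z measure) \<Rightarrow>
   ('j \<Rightarrow> 'w \<Rightarrow> real) \<Rightarrow> ('k \<Rightarrow> 'w \<Rightarrow> real) \<Rightarrow> 'j set \<Rightarrow> 'k set \<Rightarrow> ereal"
  where
  "target_T W Z \<mu> \<kappa> g1 g2 J K = discrepancy Z \<mu> \<kappa> (admissible W g1 g2 J K)"

(* The combination of Dirac measures lives on the sigma-algebra of W, where singletons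
   need not be measurable; hence it is not given as a point_measure. *)
definition dirac_sum :: "'w measure \<Rightarrow> 'w set \<Rightarrow> ('w \<Rightarrow> real) \<Rightarrow> 'w measure" where
  "dirac_sum W W' p =
    measure_of (space W) (sets W)
      (\<lambda>A. \<Sum>w\<in>W'. ennreal (p w) * emeasure (return W w) A)"

lemma space_dirac_sum [simp]: "space (dirac_sum W W' p) = space W"
  and sets_dirac_sum [simp, measurable_cong]: "sets (dirac_sum W W' p) = sets W"
  by (simp_all add: dirac_sum_def)

lemma emeasure_dirac_sum:
  assumes "A \<in> sets W"
  shows "emeasure (dirac_sum W W' p) A = (\<Sum>w\<in>W'. ennreal (p w) * emeasure (return W w) A)"
proof (rule emeasure_measure_of[OF dirac_sum_def])
  show "sets W \<subseteq> Pow (space W)"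
    by (rule sets.space_closed)
  show "A \<in> sets (dirac_sum W W' p)"
    using assms by simp
  show "positive (sets (dirac_sum W W' p))
      (\<lambda>A. \<Sum>w\<in>W'. ennreal (p w) * emeasure (return W w) A)"
    by (simp add: positive_def)
  show "countably_additive (sets (dirac_sum W W' p))
      (\<lambda>A. \<Sum>w\<in>W'. ennreal (p w) * emeasure (return W w) A)"
  proof (rule countably_additiveI)
    fix B :: "nat \<Rightarrow> 'a set"
    assume B: "range B \<subseteq> sets (dirac_sum W W' p)" "disjoint_family B"
    have "(\<Sum>i. \<Sum>w\<in>W'. ennreal (p w) * emeasure (return W w) (B i)) =
        (\<Sum>w\<in>W'. \<Sum>i. ennreal (p w) * emeasure (return W w) (B i))"
      by (rule suminf_sum) simp
    also have "\<dots> = (\<Sum>w\<in>W'. ennreal (p w) * emeasure (return W w) (\<Union>i. B i))"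
      using B by (intro sum.cong refl, subst ennreal_suminf_cmult)
        (simp add: suminf_emeasure del: emeasure_return)
    finally show "(\<Sum>i. \<Sum>w\<in>W'. ennreal (p w) * emeasure (return W w) (B i)) =
        (\<Sum>w\<in>W'. ennreal (p w) * emeasure (return W w) (\<Union>i. B i))" .
  qed
qed

definition restricted_admissible ::
  "'w measure \<Rightarrow> ('j \<Rightarrow> 'w \<Rightarrow> real) \<Rightarrow> ('k \<Rightarrow> 'w \<Rightarrow> real) \<Rightarrow>
   'w set \<Rightarrow> 'j set \<Rightarrow> 'k set \<Rightarrow> 'w measure set"
  where
  "restricted_admissible W g1 g2 W' J K =
    {dirac_sum W W' p | p.
       (\<forall>w\<in>W'. 0 \<le> p w) \<and> (\<Sum>w\<in>W'. p w) = 1 \<and>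
       (\<forall>j\<in>J. (\<integral>w. g1 j w \<partial>dirac_sum W W' p) = 0) \<and>
       (\<forall>k\<in>K. (\<integral>w. g2 k w \<partial>dirac_sum W W' p) \<le> 0)}"

definition restricted_T ::
  "'w measure \<Rightarrow> 'z measure \<Rightarrow> 'z measure \<Rightarrow> ('w \<Rightarrow> 'z measure) \<Rightarrow>
   ('j \<Rightarrow> 'w \<Rightarrow> real) \<Rightarrow> ('k \<Rightarrow> 'w \<Rightarrow> real) \<Rightarrow> 'w set \<Rightarrow> 'j set \<Rightarrow> 'k set \<Rightarrow> ereal"
  where
  "restricted_T W Z \<mu> \<kappa> g1 g2 W' J K =
    discrepancy Z \<mu> \<kappa> (restricted_admissible W g1 g2 W' J K)"

definition column_certified ::
  "'w measure \<Rightarrow> 'z measure \<Rightarrow> 'z measure \<Rightarrow> ('w \<Rightarrow> 'z measure) \<Rightarrow>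
   ('j \<Rightarrow> 'w \<Rightarrow> real) \<Rightarrow> ('k \<Rightarrow> 'w \<Rightarrow> real) \<Rightarrow> 'j set \<Rightarrow> 'k set \<Rightarrow>
   'w set \<Rightarrow> 'j set \<Rightarrow> 'k set \<Rightarrow> bool"
  where
  "column_certified W Z \<mu> \<kappa> g1 g2 J K W' J' K' \<longleftrightarrow>
    restricted_admissible W g1 g2 W' J K \<noteq> {} \<and>
    restricted_T W Z \<mu> \<kappa> g1 g2 W' J' K' = restricted_T W Z \<mu> \<kappa> g1 g2 W' J K"

definition lp_slack ::
  "'z measure \<Rightarrow> ('w \<Rightarrow> 'z measure) \<Rightarrow> ('j \<Rightarrow> 'w \<Rightarrow> real) \<Rightarrow> ('k \<Rightarrow> 'w \<Rightarrow> real) \<Rightarrow>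
   'j set \<Rightarrow> 'k set \<Rightarrow> ('z \<Rightarrow> real) \<times> real \<times> ('j \<Rightarrow> real) \<times> ('k \<Rightarrow> real) \<Rightarrow> 'w \<Rightarrow> real"
  where
  "lp_slack Z \<kappa> g1 g2 J' K' = (\<lambda>(\<phi>, \<zeta>, u, v) w.
    \<zeta> + (\<Sum>j\<in>J'. u j * g1 j w) + (\<Sum>k\<in>K'. v k * g2 k w)
      - (\<Sum>z\<in>space Z. \<phi> z * measure (\<kappa> w) {z}))"

definition lp_feasible ::
  "'z measure \<Rightarrow> ('w \<Rightarrow> 'z measure) \<Rightarrow> ('j \<Rightarrow> 'w \<Rightarrow> real) \<Rightarrow> ('k \<Rightarrow> 'w \<Rightarrow> real) \<Rightarrow>
   'w set \<Rightarrow> 'j set \<Rightarrow> 'k set \<Rightarrow> (('z \<Rightarrow> real) \<times> real \<times> ('j \<Rightarrow> real) \<times> ('k \<Rightarrow> real)) set"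
  where
  "lp_feasible Z \<kappa> g1 g2 W' J' K' =
    {(\<phi>, \<zeta>, u, v).
       \<phi> \<in> space Z \<rightarrow> {0..1} \<and> (\<forall>k\<in>K'. 0 \<le> v k) \<and>
       (\<forall>w\<in>W'. 0 \<le> lp_slack Z \<kappa> g1 g2 J' K' (\<phi>, \<zeta>, u, v) w)}"

definition lp_objective ::
  "'z measure \<Rightarrow> ('z \<Rightarrow> real) \<times> real \<times> ('j \<Rightarrow> real) \<times> ('k \<Rightarrow> real) \<Rightarrow> real"
  where
  "lp_objective \<mu> = (\<lambda>(\<phi>, \<zeta>, u, v). (\<integral>z. \<phi> z \<partial>\<mu>) - \<zeta>)"

definition lp_optimizer ::
  "'z measure \<Rightarrow> 'z measure \<Rightarrow> ('w \<Rightarrow> 'z measure) \<Rightarrow>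
   ('j \<Rightarrow> 'w \<Rightarrow> real) \<Rightarrow> ('k \<Rightarrow> 'w \<Rightarrow> real) \<Rightarrow> 'w set \<Rightarrow> 'j set \<Rightarrow> 'k set \<Rightarrow>
   ('z \<Rightarrow> real) \<times> real \<times> ('j \<Rightarrow> real) \<times> ('k \<Rightarrow> real) \<Rightarrow> bool"
  where
  "lp_optimizer Z \<mu> \<kappa> g1 g2 W' J' K' d \<longleftrightarrow>
    d \<in> lp_feasible Z \<kappa> g1 g2 W' J' K' \<and>
    (\<forall>d'\<in>lp_feasible Z \<kappa> g1 g2 W' J' K'. lp_objective \<mu> d' \<le> lp_objective \<mu> d)"

(* Taken in ereal: the slack need not be bounded below on W. *)
definition row_residual ::
  "'w measure \<Rightarrow> 'z measure \<Rightarrow> ('w \<Rightarrow> 'z measure) \<Rightarrow>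
   ('j \<Rightarrow> 'w \<Rightarrow> real) \<Rightarrow> ('k \<Rightarrow> 'w \<Rightarrow> real) \<Rightarrow> 'j set \<Rightarrow> 'k set \<Rightarrow>
   ('z \<Rightarrow> real) \<times> real \<times> ('j \<Rightarrow> real) \<times> ('k \<Rightarrow> real) \<Rightarrow> ereal"
  where
  "row_residual W Z \<kappa> g1 g2 J' K' d =
    (INF w \<in> space W. ereal (lp_slack Z \<kappa> g1 g2 J' K' d w))"

definition row_certified ::
  "'w measure \<Rightarrow> 'z measure \<Rightarrow> 'z measure \<Rightarrow> ('w \<Rightarrow> 'z measure) \<Rightarrow>
   ('j \<Rightarrow> 'w \<Rightarrow> real) \<Rightarrow> ('k \<Rightarrow> 'w \<Rightarrow> real) \<Rightarrow> 'w set \<Rightarrow> 'j set \<Rightarrow> 'k set \<Rightarrow> bool"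
  where
  "row_certified W Z \<mu> \<kappa> g1 g2 W' J' K' \<longleftrightarrow>
    (\<exists>d. lp_optimizer Z \<mu> \<kappa> g1 g2 W' J' K' d \<and> row_residual W Z \<kappa> g1 g2 J' K' d = 0)"

end

theory Submission imports Defs begin

text \<open>
  The upper bound on the target is the column certificate, because every restricted measure that
  satisfies all moment conditions is admissible. For the lower bound, a vanishing row residual makes
  the optimizer dual feasible on all of the input space; integrating its slack against an
  admissible measure shows that its test function has value at least the linear programming value.
  That this value dominates the restricted discrepancy is strong duality on the finite support,
  which follows from Farkas' lemma.
\<close>

section \<open>Farkas' lemma\<close>

text \<open>
  The induction follows Bartl's algebraic proof: a violating direction \<open>x0\<close>, on which the
  new functional is positive, is projected out of all functionals.
\<close>

lemma farkas:
  fixes a :: "'i \<Rightarrow> 'w \<Rightarrow> real" and c :: "'w \<Rightarrow> real"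
  assumes "finite I"
    and "\<And>x. (\<And>i. i \<in> I \<Longrightarrow> (\<Sum>w\<in>S. a i w * x w) \<le> 0) \<Longrightarrow> (\<Sum>w\<in>S. c w * x w) \<le> 0"
    and "finite S"
  shows "\<exists>l. (\<forall>i\<in>I. 0 \<le> l i) \<and> (\<forall>w\<in>S. c w = (\<Sum>i\<in>I. l i * a i w))"
  using assms(1,2)
proof (induction I arbitrary: a c rule: finite_induct)
  case empty
  \<comment> \<open>With no constraints left, \<open>c\<close> itself is an allowed test vector, so
    its squared norm on \<open>S\<close> is at most 0.\<close>
  have "(\<Sum>w\<in>S. c w * c w) \<le> 0"
    by (rule empty) simp
  then have "(\<Sum>w\<in>S. c w * c w) = 0"
    by (simp add: order_antisym sum_nonneg)
  then show ?case
    using \<open>finite S\<close> by (simp add: sum_nonneg_eq_0_iff)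
next
  case (insert k I)
  define D where "D f x = (\<Sum>w\<in>S. f w * x w)" for f x :: "'w \<Rightarrow> real"
  have D_diff_left: "D (\<lambda>w. f w - r * g w) x = D f x - r * D g x" for f g x r
    by (simp add: D_def left_diff_distrib sum_subtractf sum_distrib_left mult.assoc)
  have D_diff_right: "D f (\<lambda>w. x w - r * y w) = D f x - D f y * r" for f x y r
    by (simp add: D_def right_diff_distrib sum_subtractf sum_distrib_left ac_simps)
  have D_scale: "D f (\<lambda>w. r * y w) = r * D f y" for f y r
    by (simp add: D_def sum_distrib_left ac_simps)
  have imp: "D c x \<le> 0" if "\<And>i. i \<in> insert k I \<Longrightarrow> D (a i) x \<le> 0" for x
    using insert.prems[of x] that by (simp add: D_def)
  show ?case
  proof (cases "\<forall>x. (\<forall>i\<in>I. D (a i) x \<le> 0) \<longrightarrow> D c x \<le> 0")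
    \<comment> \<open>The functionals indexed by \<open>I\<close> already control \<open>c\<close>,
      so the old weights are extended by weight 0 at \<open>k\<close>.\<close>
    case True
    then obtain l where "\<forall>i\<in>I. 0 \<le> l i" "\<forall>w\<in>S. c w = (\<Sum>i\<in>I. l i * a i w)"
      using insert.IH[of a c] by (auto simp: D_def)
    moreover have "(\<Sum>i\<in>I. (l(k := 0)) i * a i w) = (\<Sum>i\<in>I. l i * a i w)" for w
      using insert.hyps by (intro sum.cong) auto
    ultimately show ?thesis
      using insert.hyps by (intro exI[of _ "l(k := 0)"]) auto
  next
    case False
    then obtain y where y: "\<And>i. i \<in> I \<Longrightarrow> D (a i) y \<le> 0" "D c y > 0"
      by force
    \<comment> \<open>Since \<open>y\<close> satisfies every old inequality but makes
      \<open>c\<close> positive, it can only fail the new one.\<close>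
    have ky: "D (a k) y > 0"
      using imp[of y] y by force
    define x0 where "x0 = (\<lambda>w. (1 / D (a k) y) * y w)"
    have x0: "D (a k) x0 = 1" "D c x0 \<ge> 0" "\<And>i. i \<in> I \<Longrightarrow> D (a i) x0 \<le> 0"
      using y ky unfolding x0_def D_scale by (auto simp: divide_simps)
    \<comment> \<open>Subtracting these multiples of \<open>a k\<close> makes every
      \<open>a' i\<close>, and likewise \<open>c'\<close>, vanish at \<open>x0\<close>, because
      \<open>a k\<close> takes the value 1 there.\<close>
    define a' where "a' = (\<lambda>i w. a i w - D (a i) x0 * a k w)"
    define c' where "c' = (\<lambda>w. c w - D c x0 * a k w)"
    have "D c' x \<le> 0" if "\<And>i. i \<in> I \<Longrightarrow> D (a' i) x \<le> 0" for x
    proof -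
      \<comment> \<open>The shifted point is the projection of \<open>x\<close> along
        \<open>x0\<close> onto the kernel of \<open>a k\<close>. On it \<open>a i\<close> and
        \<open>c\<close> take the values that \<open>a' i\<close> and \<open>c'\<close> take at
        \<open>x\<close>, so the original implication applies.\<close>
      have "D c (\<lambda>w. x w - D (a k) x * x0 w) \<le> 0"
        using that x0(1) by (intro imp) (auto simp: D_diff_right a'_def D_diff_left)
      then show ?thesis
        unfolding c'_def D_diff_left D_diff_right by simp
    qed
    then obtain l where l: "\<forall>i\<in>I. 0 \<le> l i" "\<forall>w\<in>S. c' w = (\<Sum>i\<in>I. l i * a' i w)"
      using insert.IH[of a' c'] by (auto simp: D_def)
    \<comment> \<open>This is the coefficient that \<open>a k\<close> receives when
      \<open>c'\<close> and the \<open>a' i\<close> are expanded again. The signs of the functionals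
      at \<open>x0\<close> make it nonnegative.\<close>
    define r where "r = D c x0 - (\<Sum>i\<in>I. l i * D (a i) x0)"
    have "(\<Sum>i\<in>I. l i * D (a i) x0) \<le> 0"
      using l(1) x0(3) by (intro sum_nonpos mult_nonneg_nonpos) auto
    then have "0 \<le> r"
      using x0(2) by (simp add: r_def)
    have "c w = (\<Sum>i\<in>I. l i * a i w) + r * a k w" if "w \<in> S" for w
    proof -
      have "c w - D c x0 * a k w = (\<Sum>i\<in>I. l i * a i w) - (\<Sum>i\<in>I. l i * D (a i) x0) * a k w"
        using l(2) that
        by (simp add: c'_def a'_def right_diff_distrib sum_subtractf sum_distrib_right mult.assoc)
      then show ?thesis
        by (simp add: r_def algebra_simps)
    qed
    moreover have "(\<Sum>i\<in>I. (l(k := r)) i * a i w) = (\<Sum>i\<in>I. l i * a i w)" for w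
      using insert.hyps by (intro sum.cong) auto
    ultimately show ?thesis
      using insert.hyps l(1) \<open>0 \<le> r\<close> by (intro exI[of _ "l(k := r)"]) auto
  qed
qed

text \<open>Homogenizing absorbs the normalization of \<open>p\<close>: the bound \<open>c\<close>
  on the polytope says that \<open>q - c\<close> is nonpositive on the cone of unnormalized weights,
  and Farkas' lemma turns this into multipliers. An empty polytope is covered too, since the cone is
  then trivial on \<open>S\<close>.\<close>

lemma linear_program_duality:
  fixes f :: "'j \<Rightarrow> 'w \<Rightarrow> real" and g :: "'k \<Rightarrow> 'w \<Rightarrow> real" and q :: "'w \<Rightarrow> real"
  assumes "finite S" "finite J" "finite K"
    and bound: "\<And>p. (\<And>w. w \<in> S \<Longrightarrow> 0 \<le> p w) \<Longrightarrow> (\<Sum>w\<in>S. p w) = 1 \<Longrightarrow>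
      (\<And>j. j \<in> J \<Longrightarrow> (\<Sum>w\<in>S. p w * f j w) = 0) \<Longrightarrow>
      (\<And>k. k \<in> K \<Longrightarrow> (\<Sum>w\<in>S. p w * g k w) \<le> 0) \<Longrightarrow> (\<Sum>w\<in>S. p w * q w) \<le> c"
  shows "\<exists>u v. (\<forall>k\<in>K. 0 \<le> v k) \<and>
    (\<forall>w\<in>S. q w \<le> c + (\<Sum>j\<in>J. u j * f j w) + (\<Sum>k\<in>K. v k * g k w))"
proof -
  have homogeneous: "(\<Sum>w\<in>S. x w * (q w - c)) \<le> 0"
    if x: "\<And>w. w \<in> S \<Longrightarrow> 0 \<le> x w" "\<And>j. j \<in> J \<Longrightarrow> (\<Sum>w\<in>S. x w * f j w) = 0"
      "\<And>k. k \<in> K \<Longrightarrow> (\<Sum>w\<in>S. x w * g k w) \<le> 0" for x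
  \<comment> \<open>A nonnegative vector of total mass 0 vanishes on \<open>S\<close>; any other one
    can be rescaled to total mass 1.\<close>
  proof (cases "(\<Sum>w\<in>S. x w) = 0")
    case True
    then have "\<forall>w\<in>S. x w = 0"
      using x(1) \<open>finite S\<close> by (simp add: sum_nonneg_eq_0_iff)
    then show ?thesis
      by simp
  next
    case False
    define t where "t = (\<Sum>w\<in>S. x w)"
    have t: "t > 0"
      using False x(1) unfolding t_def by (simp add: sum_nonneg order_less_le)
    have scale: "(\<Sum>w\<in>S. x w * h w / t) = (\<Sum>w\<in>S. x w * h w) / t" for h
      by (simp add: sum_divide_distrib)
    have "(\<Sum>w\<in>S. x w / t * q w) \<le> c"
    proof (rule bound)
      show "(\<Sum>w\<in>S. x w / t) = 1"
        using t by (simp add: t_def flip: sum_divide_distrib)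
    qed (use x t in \<open>auto simp: scale divide_nonpos_pos\<close>)
    then have "(\<Sum>w\<in>S. x w * q w) \<le> c * t"
      using t by (simp add: scale pos_divide_le_eq)
    then show ?thesis
      by (simp add: right_diff_distrib sum_subtractf t_def sum_distrib_left mult.commute)
  qed
  \<comment> \<open>The cone is written with inequalities of one direction only: \<open>S\<close>
    indexes the sign constraints as \<open>- x w0 \<le> 0\<close>, the two copies of
    \<open>J\<close> split each equation into two opposite inequalities, and \<open>K\<close> is
    kept as it is.\<close>
  define a where "a = case_sum (\<lambda>w0 w. if w = w0 then - 1 else 0)
    (case_sum f (case_sum (\<lambda>j w. - f j w) g))"
  let ?I = "S <+> (J <+> (J <+> K))"
  have "\<exists>l. (\<forall>i\<in>?I. 0 \<le> l i) \<and> (\<forall>w\<in>S. q w - c = (\<Sum>i\<in>?I. l i * a i w))"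
  proof (rule farkas)
    fix x :: "'w \<Rightarrow> real"
    assume x: "\<And>i. i \<in> ?I \<Longrightarrow> (\<Sum>w\<in>S. a i w * x w) \<le> 0"
    have "(\<Sum>w\<in>S. x w * (q w - c)) \<le> 0"
    proof (rule homogeneous)
      show "0 \<le> x w" if "w \<in> S" for w
        using x[OF InlI[OF that]] that \<open>finite S\<close>
        by (simp add: a_def if_distrib[of "\<lambda>r. r * _"] sum.delta cong: if_cong)
      show "(\<Sum>w\<in>S. x w * f j w) = 0" if "j \<in> J" for j
        using x[OF InrI[OF InlI[OF that]]] x[OF InrI[OF InrI[OF InlI[OF that]]]]
        by (simp add: a_def sum_negf mult.commute)
      show "(\<Sum>w\<in>S. x w * g k w) \<le> 0" if "k \<in> K" for k
        using x[OF InrI[OF InrI[OF InrI[OF that]]]] by (simp add: a_def mult.commute)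
    qed
    then show "(\<Sum>w\<in>S. (q w - c) * x w) \<le> 0"
      by (simp add: mult.commute)
  qed (use assms(1-3) in auto)
  then obtain l where l: "\<forall>i\<in>?I. 0 \<le> l i"
    and eq: "\<forall>w\<in>S. q w - c = (\<Sum>i\<in>?I. l i * a i w)"
    by (elim exE conjE)
  show ?thesis
  proof (intro exI conjI ballI)
    show "0 \<le> l (Inr (Inr (Inr k)))" if "k \<in> K" for k
      using bspec[OF l InrI[OF InrI[OF InrI[OF that]]]] .
    \<comment> \<open>The two nonnegative weights of a split equation combine into one multiplier of
      free sign. The weight of the sign constraint at \<open>w\<close> is exactly the gap in the
      inequality.\<close>
    show "q w \<le> c + (\<Sum>j\<in>J. (l (Inr (Inl j)) - l (Inr (Inr (Inl j)))) * f j w)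
      + (\<Sum>k\<in>K. l (Inr (Inr (Inr k))) * g k w)" if "w \<in> S" for w
    proof -
      have "(\<Sum>w0\<in>S. l (Inl w0) * a (Inl w0) w) = - l (Inl w)"
        using that \<open>finite S\<close> by (simp add: a_def if_distrib sum.delta' cong: if_cong)
      moreover have "0 \<le> l (Inl w)"
        using bspec[OF l InlI[OF that]] .
      ultimately show ?thesis
        using bspec[OF eq that] assms(1-3)
        by (simp add: sum.Plus a_def left_diff_distrib sum_subtractf sum_negf)
    qed
  qed
qed

section \<open>Integrals\<close>

lemma integral_finite_space:
  fixes f :: "'a \<Rightarrow> real"
  assumes "finite_measure M" "finite (space M)" "sets M = Pow (space M)"
  shows "(\<integral>z. f z \<partial>M) = (\<Sum>z\<in>space M. f z * measure M {z})"
proof -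
  interpret finite_measure M by fact
  have "(\<integral>z. f z \<partial>M) = (\<integral>z. (\<Sum>y\<in>space M. f y * indicator {y} z) \<partial>M)"
    using assms(2)
    by (intro Bochner_Integration.integral_cong refl)
      (simp add: indicator_def if_distrib sum.delta cong: if_cong)
  also have "\<dots> = (\<Sum>y\<in>space M. f y * measure M {y})"
    using assms(3) by (subst Bochner_Integration.integral_sum) (auto simp: emeasure_eq_measure Int_absorb1)
  finally show ?thesis .
qed

text \<open>A point measure carries the full power set of \<open>S\<close>; pushing it forward along
  the inclusion moves it to the sigma-algebra of \<open>W\<close>. Integrals against Dirac
  combinations thereby become finite sums, even where singletons of \<open>W\<close> are not
  measurable.\<close>

lemma dirac_sum_eq_distr:
  assumes "finite S" "S \<subseteq> space W"
  shows "dirac_sum W S p = distr (point_measure S p) W (\<lambda>w. w)"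
proof (rule measure_eqI)
  fix A assume "A \<in> sets (dirac_sum W S p)"
  then have A: "A \<in> sets W"
    by simp
  have "emeasure (distr (point_measure S p) W (\<lambda>w. w)) A = (\<Sum>w\<in>A \<inter> S. ennreal (p w))"
    using A assms
    by (subst emeasure_distr) (auto simp: space_point_measure emeasure_point_measure_finite)
  also have "\<dots> = (\<Sum>w\<in>S. ennreal (p w) * emeasure (return W w) A)"
    using A assms(1)
    by (intro sum.mono_neutral_cong_left) (auto simp: indicator_def)
  finally show "emeasure (dirac_sum W S p) A = emeasure (distr (point_measure S p) W (\<lambda>w. w)) A"
    using A by (simp add: emeasure_dirac_sum)
qed simp

lemma
  fixes f :: "'w \<Rightarrow> real"
  assumes "finite S" "S \<subseteq> space W" "\<And>w. w \<in> S \<Longrightarrow> 0 \<le> p w" "f \<in> borel_measurable W"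
  shows integrable_dirac_sum: "integrable (dirac_sum W S p) f"
    and integral_dirac_sum: "(\<integral>w. f w \<partial>dirac_sum W S p) = (\<Sum>w\<in>S. p w * f w)"
proof -
  have id: "(\<lambda>w. w) \<in> point_measure S p \<rightarrow>\<^sub>M W"
    using assms(2) by auto
  show "integrable (dirac_sum W S p) f"
    using assms id by (simp add: dirac_sum_eq_distr integrable_distr_eq integrable_point_measure_finite)
  show "(\<integral>w. f w \<partial>dirac_sum W S p) = (\<Sum>w\<in>S. p w * f w)"
    using assms id by (simp add: dirac_sum_eq_distr integral_distr lebesgue_integral_point_measure_finite)
qed

lemma dirac_sum_in_prob_algebra:
  assumes "finite S" "S \<subseteq> space W" "\<And>w. w \<in> S \<Longrightarrow> 0 \<le> p w" "(\<Sum>w\<in>S. p w) = 1"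
  shows "dirac_sum W S p \<in> space (prob_algebra W)"
proof -
  have "emeasure (dirac_sum W S p) (space W) = (\<Sum>w\<in>S. ennreal (p w))"
    using assms(2) by (subst emeasure_dirac_sum) (auto intro!: sum.cong)
  also have "\<dots> = 1"
    using assms(3,4) by simp
  finally show ?thesis
    by (auto simp: space_prob_algebra intro!: prob_spaceI)
qed

text \<open>Since \<open>Z\<close> is finite, \<open>\<phi>\<close> is a finite combination of
  singleton indicators, so the formula for the mass of a singleton under \<open>bind\<close> and
  linearity suffice. The result is an adjoint identity: testing the output law with
  \<open>\<phi>\<close> amounts to averaging over \<open>\<gamma>\<close> the function subtracted in
  \<open>lp_slack\<close>.\<close>

lemma
  fixes \<phi> :: "'z \<Rightarrow> real"
  assumes Z: "finite (space Z)" "sets Z = Pow (space Z)"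
    and \<kappa>: "\<kappa> \<in> W \<rightarrow>\<^sub>M prob_algebra Z" and \<gamma>: "\<gamma> \<in> space (prob_algebra W)"
  shows integrable_kernel_mass:
      "integrable \<gamma> (\<lambda>w. \<Sum>z\<in>space Z. \<phi> z * measure (\<kappa> w) {z})"
    and integral_output_law:
      "(\<integral>z. \<phi> z \<partial>output_law \<kappa> \<gamma>) = (\<integral>w. (\<Sum>z\<in>space Z. \<phi> z * measure (\<kappa> w) {z}) \<partial>\<gamma>)"
proof -
  have sets_\<gamma>: "sets \<gamma> = sets W"
    using \<gamma> by (simp add: space_prob_algebra)
  interpret prob_space \<gamma>
    using \<gamma> by (simp add: space_prob_algebra)
  have \<kappa>': "\<kappa> \<in> \<gamma> \<rightarrow>\<^sub>M subprob_algebra Z"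
    using measurable_prob_algebraD[OF \<kappa>] measurable_cong_sets[OF sets_\<gamma> refl] by blast
  have sets_L: "sets (\<gamma> \<bind> \<kappa>) = sets Z"
    by (rule sets_bind'[OF \<gamma> \<kappa>])
  have space_L: "space (\<gamma> \<bind> \<kappa>) = space Z"
    by (rule sets_eq_imp_space_eq[OF sets_L])
  have mass: "integrable \<gamma> (\<lambda>w. measure (\<kappa> w) {z})" if "z \<in> space Z" for z
  proof (rule integrable_const_bound[of _ 1])
    show "AE w in \<gamma>. norm (measure (\<kappa> w) {z}) \<le> 1"
      using subprob_space_kernel[OF \<kappa>'] by (intro AE_I2) (simp add: subprob_space.subprob_measure_le_1)
    show "(\<lambda>w. measure (\<kappa> w) {z}) \<in> borel_measurable \<gamma>"
      using that Z(2) by (intro measurable_compose[OF \<kappa>' measurable_measure_subprob_algebra]) auto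
  qed
  then show "integrable \<gamma> (\<lambda>w. \<Sum>z\<in>space Z. \<phi> z * measure (\<kappa> w) {z})"
    by simp
  have "finite_measure (\<gamma> \<bind> \<kappa>)"
    using prob_space_bind'[OF \<gamma> \<kappa>] by (simp add: prob_space_def)
  then have "(\<integral>z. \<phi> z \<partial>output_law \<kappa> \<gamma>) = (\<Sum>z\<in>space Z. \<phi> z * measure (\<gamma> \<bind> \<kappa>) {z})"
    using Z by (simp add: output_law_def integral_finite_space space_L sets_L)
  also have "\<dots> = (\<Sum>z\<in>space Z. \<phi> z * (\<integral>w. measure (\<kappa> w) {z} \<partial>\<gamma>))"
    using Z(2) by (intro sum.cong refl, subst measure_bind[OF \<kappa>']) auto
  also have "\<dots> = (\<integral>w. (\<Sum>z\<in>space Z. \<phi> z * measure (\<kappa> w) {z}) \<partial>\<gamma>)"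
    using mass by (subst Bochner_Integration.integral_sum) auto
  finally show "(\<integral>z. \<phi> z \<partial>output_law \<kappa> \<gamma>) =
      (\<integral>w. (\<Sum>z\<in>space Z. \<phi> z * measure (\<kappa> w) {z}) \<partial>\<gamma>)" .
qed

section \<open>The two certificates\<close>

lemma discrepancy_antimono:
  assumes "G \<subseteq> H"
  shows "discrepancy Z \<mu> \<kappa> H \<le> discrepancy Z \<mu> \<kappa> G"
  unfolding discrepancy_def by (intro SUP_mono' INF_superset_mono assms order_refl)

text \<open>A finitely supported measure integrates every measurable function, so the integrability
  demanded by \<open>admissible\<close> comes for free.\<close>

lemma restricted_admissible_subset:
  assumes "finite S" "S \<subseteq> space W"
    and "\<And>j. j \<in> J \<Longrightarrow> g1 j \<in> borel_measurable W" "\<And>k. k \<in> K \<Longrightarrow> g2 k \<in> borel_measurable W"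
  shows "restricted_admissible W g1 g2 S J K \<subseteq> admissible W g1 g2 J K"
  using assms
  by (auto simp: restricted_admissible_def admissible_def
      intro!: dirac_sum_in_prob_algebra integrable_dirac_sum)

text \<open>If some \<open>\<phi>\<close> had a larger infimum, duality would supply multipliers
  that complete \<open>\<phi>\<close> to a feasible point of larger objective, contradicting
  optimality of \<open>d\<close>.\<close>

lemma restricted_T_le_optimum:
  assumes Z: "finite (space Z)" "sets Z = Pow (space Z)" and \<kappa>: "\<kappa> \<in> W \<rightarrow>\<^sub>M prob_algebra Z"
    and g: "\<And>j. j \<in> J \<Longrightarrow> g1 j \<in> borel_measurable W" "\<And>k. k \<in> K \<Longrightarrow> g2 k \<in> borel_measurable W"
    and S: "finite S" "S \<subseteq> space W" and fin: "finite J" "finite K"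
    and opt: "lp_optimizer Z \<mu> \<kappa> g1 g2 S J K d"
  shows "restricted_T W Z \<mu> \<kappa> g1 g2 S J K \<le> ereal (lp_objective \<mu> d)"
  unfolding restricted_T_def discrepancy_def
proof (rule SUP_least, rule ccontr)
  fix \<phi>
  assume \<phi>: "\<phi> \<in> space Z \<rightarrow> {0..1::real}"
  define q where "q w = (\<Sum>z\<in>space Z. \<phi> z * measure (\<kappa> w) {z})" for w
  let ?V = "INF \<gamma>\<in>restricted_admissible W g1 g2 S J K.
    ereal ((\<integral>z. \<phi> z \<partial>\<mu>) - (\<integral>z. \<phi> z \<partial>output_law \<kappa> \<gamma>))"
  assume "\<not> ?V \<le> ereal (lp_objective \<mu> d)"
  \<comment> \<open>A real strictly in between is used because the infimum itself may be
    \<open>\<infinity>\<close>, namely when no restricted measure meets the constraints.\<close>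
  then obtain r where r: "lp_objective \<mu> d < r" "ereal r < ?V"
    by (metis ereal_dense2 ereal_less(2) less_ereal.simps(1) not_le)
  have q_meas: "q \<in> borel_measurable W"
    unfolding q_def using \<kappa> Z(2)
    by (intro borel_measurable_sum borel_measurable_times borel_measurable_const
        measurable_compose[OF \<kappa> measurable_measure_prob_algebra]) auto
  have bound: "(\<Sum>w\<in>S. p w * q w) \<le> (\<integral>z. \<phi> z \<partial>\<mu>) - r"
    if p: "\<And>w. w \<in> S \<Longrightarrow> 0 \<le> p w" "(\<Sum>w\<in>S. p w) = 1"
      "\<And>j. j \<in> J \<Longrightarrow> (\<Sum>w\<in>S. p w * g1 j w) = 0"
      "\<And>k. k \<in> K \<Longrightarrow> (\<Sum>w\<in>S. p w * g2 k w) \<le> 0" for p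
  proof -
    have "dirac_sum W S p \<in> restricted_admissible W g1 g2 S J K"
      unfolding restricted_admissible_def using p S g
      by (auto simp: integral_dirac_sum intro!: exI[of _ p])
    then have "?V \<le> ereal ((\<integral>z. \<phi> z \<partial>\<mu>) - (\<integral>z. \<phi> z \<partial>output_law \<kappa> (dirac_sum W S p)))"
      by (rule INF_lower)
    then have "r \<le> (\<integral>z. \<phi> z \<partial>\<mu>) - (\<integral>z. \<phi> z \<partial>output_law \<kappa> (dirac_sum W S p))"
      using r(2) by (simp flip: ereal_less_eq(3))
    also have "(\<integral>z. \<phi> z \<partial>output_law \<kappa> (dirac_sum W S p)) = (\<Sum>w\<in>S. p w * q w)"
      using integral_output_law[OF Z \<kappa> dirac_sum_in_prob_algebra[OF S p(1,2)], of \<phi>]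
        integral_dirac_sum[OF S p(1) q_meas]
      by (simp add: q_def)
    finally show ?thesis
      by simp
  qed
  have "\<exists>u v. (\<forall>k\<in>K. 0 \<le> v k) \<and> (\<forall>w\<in>S.
      q w \<le> (\<integral>z. \<phi> z \<partial>\<mu>) - r + (\<Sum>j\<in>J. u j * g1 j w) + (\<Sum>k\<in>K. v k * g2 k w))"
    by (rule linear_program_duality[OF S(1) fin]) (fact bound)
  then obtain u v where v: "\<forall>k\<in>K. 0 \<le> v k"
    and uv: "\<forall>w\<in>S.
      q w \<le> (\<integral>z. \<phi> z \<partial>\<mu>) - r + (\<Sum>j\<in>J. u j * g1 j w) + (\<Sum>k\<in>K. v k * g2 k w)"
    by blast
  \<comment> \<open>The primal bound serves as \<open>\<zeta>\<close>, which makes the objective of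
    this point exactly \<open>r\<close>.\<close>
  have "(\<phi>, (\<integral>z. \<phi> z \<partial>\<mu>) - r, u, v) \<in> lp_feasible Z \<kappa> g1 g2 S J K"
    using \<phi> v uv by (auto simp: lp_feasible_def lp_slack_def q_def)
  then have "r \<le> lp_objective \<mu> d"
    using opt unfolding lp_optimizer_def by (auto simp: lp_objective_def)
  with r(1) show False
    by simp
qed

text \<open>This is weak duality on the whole input space: the nonnegative residual extends the
  constraints from the support to every point, so \<open>\<phi>\<close> alone witnesses the bound on
  the supremum.\<close>

lemma objective_le_target_T:
  assumes Z: "finite (space Z)" "sets Z = Pow (space Z)" and \<kappa>: "\<kappa> \<in> W \<rightarrow>\<^sub>M prob_algebra Z"
    and sub: "J' \<subseteq> J" "K' \<subseteq> K"
    and feasible: "d \<in> lp_feasible Z \<kappa> g1 g2 S J' K'"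
    and residual: "0 \<le> row_residual W Z \<kappa> g1 g2 J' K' d"
  shows "ereal (lp_objective \<mu> d) \<le> target_T W Z \<mu> \<kappa> g1 g2 J K"
proof -
  obtain \<phi> \<zeta> u v where d: "d = (\<phi>, \<zeta>, u, v)"
    by (metis prod_cases4)
  have \<phi>: "\<phi> \<in> space Z \<rightarrow> {0..1}" and v: "\<And>k. k \<in> K' \<Longrightarrow> 0 \<le> v k"
    using feasible by (auto simp: d lp_feasible_def)
  define q where "q w = (\<Sum>z\<in>space Z. \<phi> z * measure (\<kappa> w) {z})" for w
  have slack: "q w \<le> \<zeta> + (\<Sum>j\<in>J'. u j * g1 j w) + (\<Sum>k\<in>K'. v k * g2 k w)"
    if "w \<in> space W" for w
    using residual that by (simp add: row_residual_def le_INF_iff d lp_slack_def q_def)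
  have "(\<integral>z. \<phi> z \<partial>output_law \<kappa> \<gamma>) \<le> \<zeta>" if \<gamma>: "\<gamma> \<in> admissible W g1 g2 J K" for \<gamma>
  proof -
    have prob: "\<gamma> \<in> space (prob_algebra W)"
      and g1: "\<And>j. j \<in> J' \<Longrightarrow> integrable \<gamma> (g1 j)" "\<And>j. j \<in> J' \<Longrightarrow> (\<integral>w. g1 j w \<partial>\<gamma>) = 0"
      and g2: "\<And>k. k \<in> K' \<Longrightarrow> integrable \<gamma> (g2 k)" "\<And>k. k \<in> K' \<Longrightarrow> (\<integral>w. g2 k w \<partial>\<gamma>) \<le> 0"
      using \<gamma> sub by (auto simp: admissible_def)
    interpret prob_space \<gamma>
      using prob by (simp add: space_prob_algebra)
    have space_\<gamma>: "space \<gamma> = space W"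
      using prob by (simp add: space_prob_algebra sets_eq_imp_space_eq[of \<gamma> W])
    have int: "integrable \<gamma> (\<lambda>w. \<Sum>j\<in>J'. u j * g1 j w)" "integrable \<gamma> (\<lambda>w. \<Sum>k\<in>K'. v k * g2 k w)"
      using g1(1) g2(1) by auto
    have "(\<integral>z. \<phi> z \<partial>output_law \<kappa> \<gamma>) = (\<integral>w. q w \<partial>\<gamma>)"
      by (simp add: integral_output_law[OF Z \<kappa> prob] q_def)
    also have "\<dots> \<le> (\<integral>w. \<zeta> + (\<Sum>j\<in>J'. u j * g1 j w) + (\<Sum>k\<in>K'. v k * g2 k w) \<partial>\<gamma>)"
      using int integrable_kernel_mass[OF Z \<kappa> prob, of \<phi>] slack
      by (intro integral_mono) (auto simp: q_def space_\<gamma>)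
    also have "\<dots> = \<zeta> + (\<Sum>j\<in>J'. u j * (\<integral>w. g1 j w \<partial>\<gamma>)) + (\<Sum>k\<in>K'. v k * (\<integral>w. g2 k w \<partial>\<gamma>))"
      using int g1(1) g2(1) by (simp add: prob_space)
    \<comment> \<open>The equality moments vanish, and the inequality moments are nonpositive with
      nonnegative multipliers.\<close>
    also have "\<dots> \<le> \<zeta>"
      using g1(2) g2(2) v by (simp add: sum_nonpos mult_nonneg_nonpos)
    finally show ?thesis .
  qed
  then have "ereal (lp_objective \<mu> d) \<le>
      (INF \<gamma>\<in>admissible W g1 g2 J K. ereal ((\<integral>z. \<phi> z \<partial>\<mu>) - (\<integral>z. \<phi> z \<partial>output_law \<kappa> \<gamma>)))"
    by (intro INF_greatest) (simp add: d lp_objective_def)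
  also have "\<dots> \<le> target_T W Z \<mu> \<kappa> g1 g2 J K"
    unfolding target_T_def discrepancy_def by (rule SUP_upper[OF \<phi>])
  finally show ?thesis .
qed

theorem theorem2:
  fixes Y :: "'y measure" and X :: "'x measure" and U :: "'u measure"
    and \<Theta> :: "'t set" and \<theta> :: 't
    and J J' :: "'j set" and K K' :: "'k set"
    and g1 :: "'t \<Rightarrow> 'j \<Rightarrow> 'x \<times> 'u \<Rightarrow> real" and g2 :: "'t \<Rightarrow> 'k \<Rightarrow> 'x \<times> 'u \<Rightarrow> real"
    and \<kappa> :: "'t \<Rightarrow> 'x \<times> 'u \<Rightarrow> ('y \<times> 'x) measure"
    and \<mu> :: "('y \<times> 'x) measure" and W' :: "('x \<times> 'u) set"
  defines "W \<equiv> X \<Otimes>\<^sub>M U" and "Z \<equiv> Y \<Otimes>\<^sub>M X"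
  assumes "finite (space Z)" and "sets Z = Pow (space Z)"
    and "\<And>\<theta>' j. \<theta>' \<in> \<Theta> \<Longrightarrow> j \<in> J \<Longrightarrow> g1 \<theta>' j \<in> borel_measurable W"
    and "\<And>\<theta>' k. \<theta>' \<in> \<Theta> \<Longrightarrow> k \<in> K \<Longrightarrow> g2 \<theta>' k \<in> borel_measurable W"
    and "\<And>\<theta>'. \<theta>' \<in> \<Theta> \<Longrightarrow> output_kernel Y X U (\<kappa> \<theta>')"
    and "\<theta> \<in> \<Theta>"
    and "\<mu> \<in> space (prob_algebra Z)"
    and "W' \<subseteq> space W" and "W' \<noteq> {}" and "finite W'"
    and "J' \<subseteq> J" and "finite J'" and "K' \<subseteq> K" and "finite K'"
    and "column_certified W Z \<mu> (\<kappa> \<theta>) (g1 \<theta>) (g2 \<theta>) J K W' J' K'"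
    and "row_certified W Z \<mu> (\<kappa> \<theta>) (g1 \<theta>) (g2 \<theta>) W' J' K'"
  shows "restricted_T W Z \<mu> (\<kappa> \<theta>) (g1 \<theta>) (g2 \<theta>) W' J' K' =
         target_T W Z \<mu> (\<kappa> \<theta>) (g1 \<theta>) (g2 \<theta>) J K"
proof (rule antisym)
  have \<kappa>: "\<kappa> \<theta> \<in> W \<rightarrow>\<^sub>M prob_algebra Z"
    using assms(7)[OF \<open>\<theta> \<in> \<Theta>\<close>] by (simp add: output_kernel_def W_def Z_def)
  note Z = assms(3,4)
  note g1 = assms(5)[OF \<open>\<theta> \<in> \<Theta>\<close>] and g2 = assms(6)[OF \<open>\<theta> \<in> \<Theta>\<close>]
  obtain d where opt: "lp_optimizer Z \<mu> (\<kappa> \<theta>) (g1 \<theta>) (g2 \<theta>) W' J' K' d"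
    and residual: "row_residual W Z (\<kappa> \<theta>) (g1 \<theta>) (g2 \<theta>) J' K' d = 0"
    using \<open>row_certified _ _ _ _ _ _ _ _ _\<close> by (auto simp: row_certified_def)
  \<comment> \<open>The objective value of the row-certified optimizer is interposed between the two
    discrepancies.\<close>
  have "restricted_T W Z \<mu> (\<kappa> \<theta>) (g1 \<theta>) (g2 \<theta>) W' J' K' \<le> ereal (lp_objective \<mu> d)"
    using \<open>J' \<subseteq> J\<close> \<open>K' \<subseteq> K\<close> g1 g2
    by (intro restricted_T_le_optimum[OF Z \<kappa> _ _ \<open>finite W'\<close> \<open>W' \<subseteq> space W\<close>
          \<open>finite J'\<close> \<open>finite K'\<close> opt]) auto
  also have "\<dots> \<le> target_T W Z \<mu> (\<kappa> \<theta>) (g1 \<theta>) (g2 \<theta>) J K"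
    using opt residual
    by (intro objective_le_target_T[OF Z \<kappa> \<open>J' \<subseteq> J\<close> \<open>K' \<subseteq> K\<close>]) (auto simp: lp_optimizer_def)
  finally show "restricted_T W Z \<mu> (\<kappa> \<theta>) (g1 \<theta>) (g2 \<theta>) W' J' K' \<le>
      target_T W Z \<mu> (\<kappa> \<theta>) (g1 \<theta>) (g2 \<theta>) J K" .
  \<comment> \<open>The inclusion into the admissible measures is applied with all moment conditions
    of \<open>J\<close> and \<open>K\<close> imposed; the column certificate then exchanges these
    for \<open>J'\<close> and \<open>K'\<close> without changing the value.\<close>
  have "target_T W Z \<mu> (\<kappa> \<theta>) (g1 \<theta>) (g2 \<theta>) J K \<le>
      restricted_T W Z \<mu> (\<kappa> \<theta>) (g1 \<theta>) (g2 \<theta>) W' J K"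
    unfolding target_T_def restricted_T_def
    by (intro discrepancy_antimono restricted_admissible_subset \<open>finite W'\<close> \<open>W' \<subseteq> space W\<close> g1 g2)
  then show "target_T W Z \<mu> (\<kappa> \<theta>) (g1 \<theta>) (g2 \<theta>) J K \<le>
      restricted_T W Z \<mu> (\<kappa> \<theta>) (g1 \<theta>) (g2 \<theta>) W' J' K'"
    using \<open>column_certified _ _ _ _ _ _ _ _ _ _ _\<close> by (simp add: column_certified_def)
qed

end
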